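(* There is an absolute constant $C>0$ such that the following holds. Let $l\ge1$ and $\bar L\ge2\alpha>0$ be given. For every first-order method in the class $\mathcal F$ (defined in the context) with an arbitrary starting point $x^0$, there exists an infinite-dimensional problem $\min_{x\in X}\{f(x)+u(x)\}$ subject to $g(x)\le0$, with $\|\lambda^*\|=l$, $f$ affine and aggregate smoothness constant $L(\Lambda_1)\le\bar L$, such that for every $0<\epsilon\le\|x^0-x^*\|^2$, at least $$C\sqrt{\frac{\bar L}{\alpha}}\,\log\frac{\|x^0-x^*\|^2}{\epsilon}$$ queries to the first-order oracle are required to find an iterate $x^N$ satisfying $\|x^N-x^*\|^2\le\epsilon$.
   Context: Problem class: $\min_{x\in X}\{F(x)=f(x)+u(x)\}$ subject to $g(x)\le0$, posed on a real Hilbert space (here infinite-dimensional, e.g. $\ell^2$), with $f$ and $g=(g_1,\dots,g_m)$ convex with Lipschitz continuous gradients, $u(x)=\frac\alpha2\|x\|^2$, and $X=B(0;R_X)$ a ball centered at the origin with radius $R_X\in(0,\infty]$. $x^*$ is an optimal solution and $\lambda^*\in\mathbb R^m_+$ a corresponding KKT multiplier. $L_\lambda$ denotes a Lipschitz constant of the gradient of $f+\sum_i\lambda_ig_i$, $L(\Lambda)=\sup_{\lambda\in\Lambda}L_\lambda$, and $\Lambda_r=\{0\}\cup\{\lambda^*+\lambda:\lambda\in\mathbb R^m_+,\|\lambda\|\le r\}$. First-order oracle: queried at $y$ it returns $f(y),g(y),\nabla f(y),\nabla g(y)$. Class $\mathcal F$: first-order methods that start from memory $\mathcal M_0=\{x^0\}$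 and, at the $t$-th oracle query, made at some $y\in\operatorname{span}(\mathcal M_{t-1})$, produce a (finite) memory of reachable points $$\mathcal M_t\subset\Big\{x+\eta_t\nabla f(y)+\sum_{i=1}^m\tau_{i,t}\nabla g_i(y):\ x,y\in\operatorname{span}(\mathcal M_{t-1}),\ \eta_t,\tau_{i,t}\in\mathbb R\Big\}.$$ The iterate $x^t$ after $t$ queries is an element of $\mathcal M_t$. *)

theory Defs
  imports "HOL-Analysis.Analysis"
begin

definition gradient :: "('a::real_inner \<Rightarrow> real) \<Rightarrow> 'a \<Rightarrow> 'a" where
  "gradient f x = (THE D. GDERIV f x :> D)"

lemma gradient_eqI:
  assumes "GDERIV f x :> D"
  shows "gradient f x = D"
proof -
  have "D' = D" if "GDERIV f x :> D'" for D'
  proof -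
    have "(\<lambda>h. h \<bullet> D') = (\<lambda>h. h \<bullet> D)"
      using that assms unfolding gderiv_def by (rule has_derivative_unique)
    then have "(D' - D) \<bullet> D' = (D' - D) \<bullet> D"
      by (rule fun_cong)
    then show ?thesis
      by (metis eq_iff_diff_eq_0 inner_diff_right inner_eq_zero_iff)
  qed
  with assms show ?thesis
    unfolding gradient_def by blast
qed

section \<open>Function constrained problems\<close>

text \<open>
  The side information of a problem is what is known without any query: the number
  \<open>m\<close> of constraints, the modulus \<open>\<alpha>\<close> of \<open>u\<close>, the radius \<open>R_X\<close> (possibly \<open>\<infinity>\<close>) and the
  constants \<open>L_\<lambda>\<close>.  The constraints are \<open>g_0, \<dots>, g_{m-1}\<close>, and a vector of
  \<open>\<real>^m\<close> is a function on \<open>nat\<close> that vanishes outside \<open>{..<m}\<close>.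
\<close>

record setting =
  ncon :: nat
  modulus :: real
  radius :: ereal
  Lip :: "(nat \<Rightarrow> real) \<Rightarrow> real"

record 'a problem = setting +
  objective :: "'a \<Rightarrow> real"
  constr :: "nat \<Rightarrow> 'a \<Rightarrow> real"

abbreviation side_info :: "'a problem \<Rightarrow> setting" where
  "side_info P \<equiv> setting.truncate P"

definition regularizer :: "'a::real_inner problem \<Rightarrow> 'a \<Rightarrow> real" where
  "regularizer P x = modulus P / 2 * (norm x)\<^sup>2"

definition total_objective :: "'a::real_inner problem \<Rightarrow> 'a \<Rightarrow> real" where
  "total_objective P x = objective P x + regularizer P x"

definition domain_ball :: "'a::real_inner problem \<Rightarrow> 'a set" where
  "domain_ball P = {x. ereal (norm x) \<le> radius P}"

definition feasible :: "'a::real_inner problem \<Rightarrow> 'a set" where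
  "feasible P = {x \<in> domain_ball P. \<forall>i<ncon P. constr P i x \<le> 0}"

definition optimal_solution :: "'a::real_inner problem \<Rightarrow> 'a \<Rightarrow> bool" where
  "optimal_solution P xs \<longleftrightarrow>
     xs \<in> feasible P \<and> (\<forall>x\<in>feasible P. total_objective P xs \<le> total_objective P x)"

definition nonneg_multipliers :: "nat \<Rightarrow> (nat \<Rightarrow> real) set" where
  "nonneg_multipliers m = {\<mu>. (\<forall>i<m. 0 \<le> \<mu> i) \<and> (\<forall>i\<ge>m. \<mu> i = 0)}"

text \<open>The last conjunct is stationarity with respect to the normal cone of the ball at \<open>xs\<close>.\<close>

definition KKT_multiplier ::
    "'a::real_inner problem \<Rightarrow> 'a \<Rightarrow> (nat \<Rightarrow> real) \<Rightarrow> bool" where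
  "KKT_multiplier P xs \<mu> \<longleftrightarrow>
     \<mu> \<in> nonneg_multipliers (ncon P) \<and>
     xs \<in> feasible P \<and>
     (\<forall>i<ncon P. \<mu> i * constr P i xs = 0) \<and>
     (\<forall>x\<in>domain_ball P.
        0 \<le> (gradient (objective P) xs + modulus P *\<^sub>R xs
              + (\<Sum>i<ncon P. \<mu> i *\<^sub>R gradient (constr P i) xs)) \<bullet> (x - xs))"

definition convex_smooth :: "('a::real_inner \<Rightarrow> real) \<Rightarrow> bool" where
  "convex_smooth f \<longleftrightarrow>
     convex_on UNIV f \<and> (\<forall>x. \<exists>D. GDERIV f x :> D) \<and> (\<exists>K. K-lipschitz_on UNIV (gradient f))"

definition admissible :: "'a::real_inner problem \<Rightarrow> bool" where
  "admissible P \<longleftrightarrow>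
     0 < modulus P \<and> 0 < radius P \<and>
     convex_smooth (objective P) \<and> (\<forall>i<ncon P. convex_smooth (constr P i)) \<and>
     (\<forall>\<mu>\<in>nonneg_multipliers (ncon P).
        (Lip P \<mu>)-lipschitz_on UNIV
          (gradient (\<lambda>x. objective P x + (\<Sum>i<ncon P. \<mu> i * constr P i x)))) \<and>
     (\<exists>xs \<mu>. optimal_solution P xs \<and> KKT_multiplier P xs \<mu>)"

definition affine_function :: "('a::real_vector \<Rightarrow> real) \<Rightarrow> bool" where
  "affine_function f \<longleftrightarrow> (\<exists>h b. linear h \<and> f = (\<lambda>x. h x + b))"

definition multiplier_norm :: "'a problem \<Rightarrow> (nat \<Rightarrow> real) \<Rightarrow> real" where
  "multiplier_norm P \<mu> = L2_set \<mu> {..<ncon P}"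

definition multiplier_set :: "'a problem \<Rightarrow> (nat \<Rightarrow> real) \<Rightarrow> real \<Rightarrow> (nat \<Rightarrow> real) set" where
  "multiplier_set P \<mu> r =
     {\<lambda>i. 0} \<union> {(\<lambda>i. \<mu> i + \<nu> i) | \<nu>. \<nu> \<in> nonneg_multipliers (ncon P) \<and> multiplier_norm P \<nu> \<le> r}"

definition aggregate_Lip :: "'a problem \<Rightarrow> (nat \<Rightarrow> real) set \<Rightarrow> ereal" where
  "aggregate_Lip P \<Lambda> = (SUP \<mu>\<in>\<Lambda>. ereal (Lip P \<mu>))"

section \<open>First-order methods\<close>

type_synonym 'a answer = "real \<times> real list \<times> 'a \<times> 'a list"

definition fo_answer :: "'a::real_inner problem \<Rightarrow> 'a \<Rightarrow> 'a answer" where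
  "fo_answer P y =
     (objective P y, map (\<lambda>i. constr P i y) [0..<ncon P],
      gradient (objective P) y, map (\<lambda>i. gradient (constr P i) y) [0..<ncon P])"

text \<open>
  A method is a triple of rules that see only the side information, the starting point and
  the answers received so far.  The previous queries need not be recorded: they are determined
  by these data.
\<close>

record 'a fo_rules =
  query_rule :: "setting \<Rightarrow> 'a \<Rightarrow> 'a answer list \<Rightarrow> 'a"
  memory_rule :: "setting \<Rightarrow> 'a \<Rightarrow> 'a answer list \<Rightarrow> 'a set"
  iterate_rule :: "setting \<Rightarrow> 'a \<Rightarrow> 'a answer list \<Rightarrow> 'a"

fun answers :: "'a::real_inner fo_rules \<Rightarrow> 'a problem \<Rightarrow> 'a \<Rightarrow> nat \<Rightarrow> 'a answer list" where
  "answers A P x0 0 = []"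
| "answers A P x0 (Suc t) =
     answers A P x0 t @ [fo_answer P (query_rule A (side_info P) x0 (answers A P x0 t))]"

text \<open>\<open>query_point A P x0 t\<close> is the point of query number \<open>t + 1\<close>; the memory and the
  iterate with index \<open>t\<close> are those available after \<open>t\<close> queries.\<close>

definition query_point :: "'a::real_inner fo_rules \<Rightarrow> 'a problem \<Rightarrow> 'a \<Rightarrow> nat \<Rightarrow> 'a" where
  "query_point A P x0 t = query_rule A (side_info P) x0 (answers A P x0 t)"

definition memory_at :: "'a::real_inner fo_rules \<Rightarrow> 'a problem \<Rightarrow> 'a \<Rightarrow> nat \<Rightarrow> 'a set" where
  "memory_at A P x0 t = memory_rule A (side_info P) x0 (answers A P x0 t)"

definition iterate_at :: "'a::real_inner fo_rules \<Rightarrow> 'a problem \<Rightarrow> 'a \<Rightarrow> nat \<Rightarrow> 'a" where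
  "iterate_at A P x0 t = iterate_rule A (side_info P) x0 (answers A P x0 t)"

text \<open>Here \<open>y\<close> ranges over all of \<open>S\<close>, not only over the point last queried, so the class of
  methods below contains the one in which gradients are combined at the queried point only.\<close>

definition reachable :: "'a::real_inner problem \<Rightarrow> 'a set \<Rightarrow> 'a set" where
  "reachable P S =
     {x + \<eta> *\<^sub>R gradient (objective P) y + (\<Sum>i<ncon P. \<tau> i *\<^sub>R gradient (constr P i) y)
      | x y \<eta> \<tau>. x \<in> S \<and> y \<in> S}"

definition first_order_method :: "'a::real_inner fo_rules \<Rightarrow> bool" where
  "first_order_method A \<longleftrightarrow>
     (\<forall>P x0. admissible P \<longrightarrow>
        memory_at A P x0 0 = {x0} \<and>
        (\<forall>t. finite (memory_at A P x0 t) \<and>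
             iterate_at A P x0 t \<in> memory_at A P x0 t \<and>
             query_point A P x0 t \<in> span (memory_at A P x0 t) \<and>
             memory_at A P x0 (Suc t) \<subseteq> reachable P (span (memory_at A P x0 t))))"

end

theory Submission
  imports Defs
begin

text \<open>
  The lower bound is Nesterov's resisting chain, with its two parts distributed over the
  objective and a single constraint.  Let \<open>e\<close> be an orthonormal sequence orthogonal to the starting
  point \<open>x0\<close>, let \<open>S\<close> be the shift that sends \<open>e i\<close> to \<open>e (i + 1)\<close> and vanishes on the orthogonal
  complement of the \<open>e i\<close>, and let \<open>A = 2 I - S - S\<^sup>*\<close>.
  The constraint is \<open>k/2 \<langle>x - x0, A (x - x0)\<rangle> \<le> const\<close>, the objective is affine and is chosen so
  that, together with the regularizer, it is centred at \<open>x0\<close> and pulls along \<open>e 0\<close> only.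
  The operator \<open>A\<close> is tridiagonal along \<open>e\<close>, so one round of gradients can enlarge the set of
  directions \<open>e i\<close> present in the memory by at most one: an iterate obtained
  after \<open>n\<close> queries is orthogonal to all \<open>e i\<close> with \<open>i \<ge> n\<close> (\<open>memory_revealed\<close>).

  With multiplier \<open>l\<close> the Lagrangian is a strongly convex quadratic.  Its stationarity condition is a
  three-term recurrence for the coordinates of \<open>xs - x0\<close>, solved by the geometric sequence
  \<open>q ^ i\<close> with \<open>q = (s - 1) / (s + 1)\<close> and \<open>s\<^sup>2 = 1 + 4 l k / \<alpha>\<close>, the condition number
  (\<open>chain_offset\<close>).  The constant in the constraint makes it active at \<open>xs\<close>, so \<open>l\<close> is a
  KKT multiplier and weak duality makes \<open>xs\<close> optimal.  The coordinates that an iterate misses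
  carry the fraction \<open>q ^ (2 n)\<close> of \<open>\<parallel>xs - x0\<parallel>\<^sup>2\<close>, which
  bounds the error from below (\<open>revealed_error\<close>), and \<open>- ln q\<close> is at most of order
  \<open>1 / s\<close> (\<open>ln_inverse_ratio_le\<close>).

  Since \<open>\<parallel>A\<parallel> \<le> 4\<close>, the constant \<open>L_\<lambda>\<close> is \<open>4 k \<lambda>\<close>, and multipliers in \<open>\<Lambda>_1\<close> are at most
  \<open>l + 1\<close>.  So \<open>k = Lbar / (4 (l + 1))\<close> is the steepest permitted constraint; it
  gives \<open>4 l k = Lbar l / (l + 1) \<ge> Lbar / 2\<close> because \<open>l \<ge> 1\<close>, so the condition number is of
  order \<open>Lbar / \<alpha>\<close>.  The instance is built from the starting point and the constants alone, so for
  a given \<open>x0\<close> the same instance defeats every method.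
\<close>

section \<open>Orthonormal sequences\<close>

definition orthonormal :: "(nat \<Rightarrow> 'a::real_inner) \<Rightarrow> bool" where
  "orthonormal v \<longleftrightarrow> (\<forall>i j. v i \<bullet> v j = (if i = j then 1 else 0))"

lemma orthonormalD:
  assumes "orthonormal v"
  shows "v i \<bullet> v j = (if i = j then 1 else 0)"
  using assms unfolding orthonormal_def by blast

lemma orthonormal_comp_inj:
  assumes "orthonormal v" and "inj f"
  shows "orthonormal (\<lambda>i. v (f i))"
  using assms unfolding orthonormal_def by (simp add: inj_eq)

lemma orthonormal_sum_inner:
  assumes "orthonormal v" and "finite I"
  shows "(\<Sum>i\<in>I. c i *\<^sub>R v i) \<bullet> (\<Sum>i\<in>I. d i *\<^sub>R v i) = (\<Sum>i\<in>I. c i * d i)"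
proof -
  have "(\<Sum>i\<in>I. c i *\<^sub>R v i) \<bullet> (\<Sum>i\<in>I. d i *\<^sub>R v i)
      = (\<Sum>i\<in>I. \<Sum>j\<in>I. if i = j then c i * d j else 0)"
    unfolding inner_sum_left inner_sum_right
    by (intro sum.cong refl) (simp add: orthonormalD[OF assms(1)])
  then show ?thesis using assms(2) by (simp add: sum.delta)
qed

lemma Bessel_inequality:
  assumes "orthonormal v" and "finite I"
  shows "(\<Sum>i\<in>I. (x \<bullet> v i)\<^sup>2) \<le> (norm x)\<^sup>2"
proof -
  define p where "p = (\<Sum>i\<in>I. (x \<bullet> v i) *\<^sub>R v i)"
  have xp: "x \<bullet> p = (\<Sum>i\<in>I. (x \<bullet> v i)\<^sup>2)"
    unfolding p_def by (simp add: inner_sum_right power2_eq_square)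
  have pp: "p \<bullet> p = (\<Sum>i\<in>I. (x \<bullet> v i)\<^sup>2)"
    unfolding p_def orthonormal_sum_inner[OF assms] by (simp add: power2_eq_square)
  have "0 \<le> (x - p) \<bullet> (x - p)" by simp
  also have "\<dots> = (norm x)\<^sup>2 - (\<Sum>i\<in>I. (x \<bullet> v i)\<^sup>2)"
    using xp pp by (simp add: inner_diff_left inner_diff_right inner_commute power2_norm_eq_inner)
  finally show ?thesis by simp
qed

lemma summable_coordinates_squared:
  assumes "orthonormal v"
  shows "summable (\<lambda>i. (x \<bullet> v i)\<^sup>2)"
  by (rule summableI_nonneg_bounded[where x = "(norm x)\<^sup>2"])
     (use Bessel_inequality[OF assms, of "{..<_}" x] in auto)

text \<open>
  By Pythagoras the squared distance of two partial sums of the vector series equals the distance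
  of the corresponding partial sums of the squared coefficients, so completeness transfers
  convergence of the latter to the former.
\<close>

lemma summable_orthonormal_series:
  fixes v :: "nat \<Rightarrow> 'a::{real_inner, complete_space}"
  assumes v: "orthonormal v" and c: "summable (\<lambda>i. (c i)\<^sup>2)"
  shows "summable (\<lambda>i. c i *\<^sub>R v i)"
proof -
  define s where "s n = (\<Sum>i<n. c i *\<^sub>R v i)" for n
  define t where "t n = (\<Sum>i<n. (c i)\<^sup>2)" for n
  have le: "(norm (s n - s m))\<^sup>2 = t n - t m" if "m \<le> n" for m n
  proof -
    have "s n - s m = (\<Sum>i\<in>{m..<n}. c i *\<^sub>R v i)"
      unfolding s_def using sum_diff_nat_ivl[of 0 m n "\<lambda>i. c i *\<^sub>R v i"] that
      by (simp add: atLeast0LessThan)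
    moreover have "t n - t m = (\<Sum>i\<in>{m..<n}. (c i)\<^sup>2)"
      unfolding t_def using sum_diff_nat_ivl[of 0 m n "\<lambda>i. (c i)\<^sup>2"] that
      by (simp add: atLeast0LessThan)
    ultimately show ?thesis
      unfolding power2_norm_eq_inner by (simp add: orthonormal_sum_inner[OF v] power2_eq_square)
  qed
  have eq: "(dist (s m) (s n))\<^sup>2 = dist (t m) (t n)" for m n
  proof (cases "m \<le> n")
    case True
    then show ?thesis using le[OF True] zero_le_power2[of "norm (s n - s m)"]
      by (simp add: dist_norm norm_minus_commute[of "s m"])
  next
    case False
    then show ?thesis using le[of n m] zero_le_power2[of "norm (s m - s n)"]
      by (simp add: dist_norm)
  qed
  have "convergent t"
    using c unfolding t_def summable_iff_convergent .
  then have Ct: "Cauchy t" by (rule convergent_Cauchy)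
  have "Cauchy s"
  proof (rule metric_CauchyI)
    fix r :: real assume "0 < r"
    then obtain M where M: "\<And>m n. m \<ge> M \<Longrightarrow> n \<ge> M \<Longrightarrow> dist (t m) (t n) < r\<^sup>2"
      using metric_CauchyD[OF Ct, of "r\<^sup>2"] by auto
    show "\<exists>M. \<forall>m\<ge>M. \<forall>n\<ge>M. dist (s m) (s n) < r"
      using M \<open>0 < r\<close> by (metis eq power2_less_imp_less less_imp_le)
  qed
  then show ?thesis
    unfolding summable_iff_convergent s_def by (rule Cauchy_convergent)
qed

lemma inner_orthonormal_series:
  fixes v :: "nat \<Rightarrow> 'a::{real_inner, complete_space}"
  assumes "orthonormal v" and "summable (\<lambda>i. (c i)\<^sup>2)"
  shows "(\<lambda>i. c i * (x \<bullet> v i)) sums (x \<bullet> (\<Sum>i. c i *\<^sub>R v i))"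
  using bounded_linear.sums[OF bounded_linear_inner_right
      summable_sums[OF summable_orthonormal_series[OF assms]], of x] by simp

lemma orthonormal_series_coordinate:
  fixes v :: "nat \<Rightarrow> 'a::{real_inner, complete_space}"
  assumes "orthonormal v" and "summable (\<lambda>i. (c i)\<^sup>2)"
  shows "v j \<bullet> (\<Sum>i. c i *\<^sub>R v i) = c j"
proof -
  have "(\<lambda>i. c i * (v j \<bullet> v i)) = (\<lambda>i. if i = j then c i else 0)"
    by (auto simp: orthonormalD[OF assms(1)])
  then show ?thesis
    using inner_orthonormal_series[OF assms, of "v j"] sums_single[of j c] sums_unique2 by metis
qed

lemma Parseval_orthonormal_series:
  fixes v :: "nat \<Rightarrow> 'a::{real_inner, complete_space}"
  assumes "orthonormal v" and "summable (\<lambda>i. (c i)\<^sup>2)"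
  shows "(\<lambda>i. (c i)\<^sup>2) sums (norm (\<Sum>i. c i *\<^sub>R v i))\<^sup>2"
  using inner_orthonormal_series[OF assms, of "\<Sum>i. c i *\<^sub>R v i"]
  unfolding power2_norm_eq_inner
  by (simp add: inner_commute[of _ "v _"] orthonormal_series_coordinate[OF assms]
      power2_eq_square)

text \<open>One Gram-Schmidt step: the normalised residual of \<open>a\<close> after projecting it onto \<open>span B\<close>.\<close>

lemma unit_vector_extending_span:
  fixes a :: "'a::real_inner"
  assumes "finite B" and orth: "\<forall>b\<in>B. \<forall>c\<in>B. b \<bullet> c = (if b = c then 1 else 0)"
    and a: "a \<notin> span B"
  shows "\<exists>u. norm u = 1 \<and> (\<forall>b\<in>B. u \<bullet> b = 0) \<and> a \<in> span (insert u B)"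
proof -
  define p where "p = (\<Sum>b\<in>B. (a \<bullet> b) *\<^sub>R b)"
  define u where "u = (1 / norm (a - p)) *\<^sub>R (a - p)"
  have p: "p \<in> span B"
    unfolding p_def by (intro span_sum span_scale span_base)
  then have ne: "norm (a - p) \<noteq> 0" using a by auto
  have "(a - p) \<bullet> b = 0" if "b \<in> B" for b
  proof -
    have "p \<bullet> b = (\<Sum>c\<in>B. if c = b then a \<bullet> b else 0)"
      unfolding p_def inner_sum_left using orth that by (intro sum.cong) auto
    then show ?thesis using that \<open>finite B\<close> by (simp add: inner_diff_left)
  qed
  then have "\<forall>b\<in>B. u \<bullet> b = 0" unfolding u_def by simp
  moreover have "norm u = 1" unfolding u_def using ne by simp
  moreover have "a = p + norm (a - p) *\<^sub>R u" unfolding u_def using ne by simp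
  then have "a \<in> span (insert u B)"
    by (metis p insertI1 span_add span_base span_scale span_mono subset_insertI subsetD)
  ultimately show ?thesis by blast
qed

lemma finite_orthonormal_spanning_set:
  fixes F :: "'a::real_inner set"
  assumes "finite F"
  shows "\<exists>B. finite B \<and> (\<forall>b\<in>B. \<forall>c\<in>B. b \<bullet> c = (if b = c then 1 else 0)) \<and> F \<subseteq> span B"
  using assms
proof (induction F)
  case empty
  show ?case by (intro exI[of _ "{}"]) auto
next
  case (insert a F)
  then obtain B where B: "finite B" "\<forall>b\<in>B. \<forall>c\<in>B. b \<bullet> c = (if b = c then 1 else 0)"
      "F \<subseteq> span B" by blast
  show ?case
  proof (cases "a \<in> span B")
    case True
    with B show ?thesis by blast
  next
    case False
    obtain u where u: "norm u = 1" "\<forall>b\<in>B. u \<bullet> b = 0" "a \<in> span (insert u B)"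
      using unit_vector_extending_span[OF B(1,2) False] by blast
    have "u \<bullet> u = 1" using u(1) by (simp add: dot_square_norm)
    then have "\<forall>b\<in>insert u B. \<forall>c\<in>insert u B. b \<bullet> c = (if b = c then 1 else 0)"
      using B(2) u(2) by (auto simp: inner_commute)
    moreover have "F \<subseteq> span (insert u B)"
      using B(3) span_mono[OF subset_insertI] by blast
    ultimately show ?thesis using B(1) u(3) by (intro exI[of _ "insert u B"]) auto
  qed
qed

lemma unit_vector_orthogonal_to_finite_set:
  fixes F :: "'a::real_inner set"
  assumes inf: "\<nexists>B :: 'a set. finite B \<and> span B = UNIV" and "finite F"
  shows "\<exists>u. norm u = 1 \<and> (\<forall>b\<in>F. u \<bullet> b = 0)"
proof -
  obtain B where B: "finite B" "\<forall>b\<in>B. \<forall>c\<in>B. b \<bullet> c = (if b = c then 1 else 0)" "F \<subseteq> span B"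
    using finite_orthonormal_spanning_set[OF \<open>finite F\<close>] by blast
  obtain a where "a \<notin> span B" using inf B(1) by blast
  then obtain u where u: "norm u = 1" "\<forall>b\<in>B. u \<bullet> b = 0"
    using unit_vector_extending_span[OF B(1,2)] by blast
  have "orthogonal u b" if "b \<in> F" for b
    using orthogonal_to_span[of b B u] B(3) u(2) that by (auto simp: orthogonal_def)
  with u(1) show ?thesis by (auto simp: orthogonal_def)
qed

text \<open>
  The only use of infinite dimension: it lets a direction be chosen orthogonal to \<open>w\<close> and to all
  earlier directions, again and again.
\<close>

lemma orthonormal_sequence_orthogonal_to:
  fixes w :: "'a::real_inner"
  assumes inf: "\<nexists>B :: 'a set. finite B \<and> span B = UNIV"
  shows "\<exists>e. orthonormal e \<and> (\<forall>i. w \<bullet> e i = 0)"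
proof -
  have "\<exists>e :: nat \<Rightarrow> 'a. \<forall>n. norm (e n) = 1 \<and> (\<forall>b\<in>insert w (e ` {..<n}). e n \<bullet> b = 0)"
  proof (rule dependent_wellorder_choice)
    show "\<exists>u. norm u = 1 \<and> (\<forall>b\<in>insert w (e ` {..<n}). u \<bullet> b = 0)" for n :: nat and e
      by (rule unit_vector_orthogonal_to_finite_set[OF inf]) simp
  next
    fix r :: 'a and f g :: "nat \<Rightarrow> 'a" and n :: nat
    assume "\<And>i. i < n \<Longrightarrow> f i = g i"
    then have "f ` {..<n} = g ` {..<n}" by auto
    then show "(norm r = 1 \<and> (\<forall>b\<in>insert w (f ` {..<n}). r \<bullet> b = 0)) =
        (norm r = 1 \<and> (\<forall>b\<in>insert w (g ` {..<n}). r \<bullet> b = 0))" by simp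
  qed
  then obtain e :: "nat \<Rightarrow> 'a" where e: "\<And>n. norm (e n) = 1" "\<And>n. e n \<bullet> w = 0"
      and lt: "\<And>i n. i < n \<Longrightarrow> e n \<bullet> e i = 0" by auto
  have "e i \<bullet> e j = (if i = j then 1 else 0)" for i j
    using lt[of i j] lt[of j i] e(1)[of i]
    by (cases i j rule: linorder_cases) (auto simp: inner_commute dot_square_norm)
  then show ?thesis using e(2) unfolding orthonormal_def by (metis inner_commute)
qed

section \<open>Shift operators\<close>

text \<open>
  The partial isometry that sends \<open>u i\<close> to \<open>v i\<close> and vanishes on the orthogonal complement of
  the sequence \<open>u\<close>.  For \<open>v i = u (i + 1)\<close> it is the right shift, and exchanging \<open>u\<close> and \<open>v\<close> gives
  its adjoint, the left shift.
\<close>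

definition transfer ::
    "(nat \<Rightarrow> 'a) \<Rightarrow> (nat \<Rightarrow> 'a) \<Rightarrow> 'a \<Rightarrow> 'a::{real_inner, complete_space}" where
  "transfer u v x = (\<Sum>i. (x \<bullet> u i) *\<^sub>R v i)"

context
  fixes u v :: "nat \<Rightarrow> 'a::{real_inner, complete_space}"
  assumes u: "orthonormal u" and v: "orthonormal v"
begin

lemma inner_transfer: "(\<lambda>i. (x \<bullet> u i) * (y \<bullet> v i)) sums (y \<bullet> transfer u v x)"
  unfolding transfer_def
  by (rule inner_orthonormal_series[OF v summable_coordinates_squared[OF u]])

lemma transfer_coordinate: "v j \<bullet> transfer u v x = x \<bullet> u j"
  unfolding transfer_def
  by (rule orthonormal_series_coordinate[OF v summable_coordinates_squared[OF u]])

lemma norm_transfer_le: "norm (transfer u v x) \<le> norm x"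
proof -
  have "(\<lambda>i. (x \<bullet> u i)\<^sup>2) sums (norm (transfer u v x))\<^sup>2"
    unfolding transfer_def
    by (rule Parseval_orthonormal_series[OF v summable_coordinates_squared[OF u]])
  then have "(norm (transfer u v x))\<^sup>2 = (\<Sum>i. (x \<bullet> u i)\<^sup>2)"
    by (rule sums_unique)
  also have "\<dots> \<le> (norm x)\<^sup>2"
    by (rule suminf_le_const[OF summable_coordinates_squared[OF u]])
       (rule Bessel_inequality[OF u finite_lessThan])
  finally have "(norm (transfer u v x))\<^sup>2 \<le> (norm x)\<^sup>2" .
  then show ?thesis by (rule power2_le_imp_le) simp
qed

lemma transfer_add: "transfer u v (x + y) = transfer u v x + transfer u v y"
  unfolding transfer_def
  using suminf_add[OF summable_orthonormal_series[OF v summable_coordinates_squared[OF u, of x]]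
      summable_orthonormal_series[OF v summable_coordinates_squared[OF u, of y]]]
  by (simp add: inner_add_left scaleR_add_left)

lemma transfer_scaleR: "transfer u v (r *\<^sub>R x) = r *\<^sub>R transfer u v x"
  unfolding transfer_def
  using suminf_scaleR_right[OF summable_orthonormal_series[OF v
        summable_coordinates_squared[OF u, of x]], of r]
  by simp

lemma bounded_linear_transfer: "bounded_linear (transfer u v)"
  by (rule bounded_linear_intro[where K = 1])
     (simp_all add: transfer_add transfer_scaleR norm_transfer_le)

end

lemma transfer_adjoint:
  fixes u v :: "nat \<Rightarrow> 'a::{real_inner, complete_space}"
  assumes u: "orthonormal u" and v: "orthonormal v"
  shows "y \<bullet> transfer u v x = x \<bullet> transfer v u y"
  using inner_transfer[OF u v, of x y] inner_transfer[OF v u, of y x]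
  by (simp add: mult.commute sums_unique2)

section \<open>Quadratic functions\<close>

definition quadratic :: "('a::real_inner \<Rightarrow> 'a) \<Rightarrow> 'a \<Rightarrow> 'a \<Rightarrow> real \<Rightarrow> 'a \<Rightarrow> real"
  where "quadratic H p b c x = (x - p) \<bullet> H (x - p) / 2 + b \<bullet> x + c"

context
  fixes H :: "'a::real_inner \<Rightarrow> 'a"
  assumes bounded: "bounded_linear H"
    and symmetric: "\<And>x y. x \<bullet> H y = y \<bullet> H x"
begin

lemma quadratic_expansion:
  "quadratic H p b c y =
     quadratic H p b c x + (H (x - p) + b) \<bullet> (y - x) + (y - x) \<bullet> H (y - x) / 2"
proof -
  define z d where "z = x - p" and "d = y - x"
  have "y - p = z + d" "y = x + d" unfolding z_def d_def by simp_all
  moreover have "H (z + d) = H z + H d"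
    using bounded by (simp add: linear_simps)
  ultimately show ?thesis
    unfolding quadratic_def z_def[symmetric] d_def[symmetric] using symmetric[of d z]
    by (simp add: inner_add_left inner_add_right inner_commute field_simps)
qed

lemma GDERIV_quadratic: "GDERIV (quadratic H p b c) x :> H (x - p) + b"
proof -
  have "((\<lambda>x. H (x - p)) has_derivative H) (at x)"
    by (rule bounded_linear.has_derivative[OF bounded]) (auto intro!: derivative_eq_intros)
  then have "((\<lambda>x. (x - p) \<bullet> H (x - p) / 2 + b \<bullet> x + c) has_derivative
      (\<lambda>h. ((x - p) \<bullet> H h + h \<bullet> H (x - p)) / 2 + b \<bullet> h)) (at x)"
    by (auto intro!: derivative_eq_intros)
  moreover have "((x - p) \<bullet> H h + h \<bullet> H (x - p)) / 2 + b \<bullet> h = h \<bullet> (H (x - p) + b)" for h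
    using symmetric[of "x - p" h] by (simp add: inner_add_right inner_commute)
  ultimately show ?thesis
    unfolding gderiv_def quadratic_def by simp
qed

lemma gradient_quadratic: "gradient (quadratic H p b c) x = H (x - p) + b"
  by (rule gradient_eqI[OF GDERIV_quadratic])

lemma lipschitz_affine_field:
  assumes K: "\<And>x. norm (H x) \<le> K * norm x" and "0 \<le> K"
  shows "K-lipschitz_on UNIV (\<lambda>x. H (x - p) + b)"
proof (rule lipschitz_onI)
  fix x y :: 'a
  have "H (x - p) - H (y - p) = H (x - y)"
    using bounded by (simp add: linear_simps)
  then show "dist (H (x - p) + b) (H (y - p) + b) \<le> K * dist x y"
    using K[of "x - y"] by (simp add: dist_norm)
qed fact

lemma convex_smooth_quadratic:
  assumes psd: "\<And>x. 0 \<le> x \<bullet> H x"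
  shows "convex_smooth (quadratic H p b c)"
  unfolding convex_smooth_def
proof (intro conjI allI)
  show "convex_on UNIV (quadratic H p b c)"
  proof (rule convex_onI)
    fix t :: real and x y :: 'a
    assume t: "0 < t" "t < 1"
    \<comment> \<open>A function above its tangent at the intermediate point \<open>m\<close> is below its chord there.\<close>
    define m where "m = (1 - t) *\<^sub>R x + t *\<^sub>R y"
    define G where "G = H (m - p) + b"
    have above: "quadratic H p b c m + G \<bullet> (w - m) \<le> quadratic H p b c w" for w
      using quadratic_expansion[of p b c w m] psd[of "w - m"] unfolding G_def by simp
    have "(1 - t) *\<^sub>R (x - m) + t *\<^sub>R (y - m) = 0"
      unfolding m_def by (simp add: algebra_simps)
    then have "(1 - t) * (G \<bullet> (x - m)) + t * (G \<bullet> (y - m)) = 0"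
      by (metis inner_add_right inner_scaleR_right inner_zero_right)
    moreover have "(1 - t) * (quadratic H p b c m + G \<bullet> (x - m)) \<le> (1 - t) * quadratic H p b c x"
      using above t by (intro mult_left_mono) auto
    moreover have "t * (quadratic H p b c m + G \<bullet> (y - m)) \<le> t * quadratic H p b c y"
      using above t by (intro mult_left_mono) auto
    ultimately show "quadratic H p b c ((1 - t) *\<^sub>R x + t *\<^sub>R y)
        \<le> (1 - t) * quadratic H p b c x + t * quadratic H p b c y"
      unfolding m_def[symmetric] by (simp add: algebra_simps)
  qed simp
  show "\<exists>D. GDERIV (quadratic H p b c) x :> D" for x
    using GDERIV_quadratic by blast
  obtain K where K: "\<And>x. norm (H x) \<le> norm x * K" "0 \<le> K"
    using bounded_linear.nonneg_bounded[OF bounded] by blast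
  have "gradient (quadratic H p b c) = (\<lambda>x. H (x - p) + b)"
    using gradient_quadratic by blast
  then show "\<exists>K. K-lipschitz_on UNIV (gradient (quadratic H p b c))"
    using lipschitz_affine_field[of K p b] K by (metis mult.commute)
qed

end

section \<open>The hard instance\<close>

text \<open>
  The parameter \<open>k\<close> is the steepness of the constraint, and \<open>l\<close> is going to be its multiplier.
\<close>

locale chain_instance =
  fixes e :: "nat \<Rightarrow> 'a::{real_inner, complete_space}" and x0 :: 'a and \<alpha> l k :: real
  assumes e: "orthonormal e" and x0_e: "\<And>i. x0 \<bullet> e i = 0"
    and pos: "0 < \<alpha>" "0 < l" "0 < k"
begin

definition chain :: "'a \<Rightarrow> 'a" where
  "chain z = 2 *\<^sub>R z - transfer e (\<lambda>i. e (Suc i)) z - transfer (\<lambda>i. e (Suc i)) e z"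

text \<open>
  The condition number of the Lagrangian is \<open>1 + 4 l k / \<alpha>\<close>: on the closed span of \<open>e\<close> the
  spectrum of \<open>chain\<close> is \<open>[0, 4]\<close>.
\<close>

definition root_cond :: real where "root_cond = sqrt (1 + 4 * l * k / \<alpha>)"

definition ratio :: real where "ratio = (root_cond - 1) / (root_cond + 1)"

definition offset :: 'a where "offset = (\<Sum>i. ratio ^ i *\<^sub>R e i)"

definition sol :: 'a where "sol = x0 + offset"

text \<open>
  The gradient \<open>- \<alpha> x0\<close> moves the centre of the regularizer from \<open>0\<close> to \<open>x0\<close>; the coefficient of
  \<open>e 0\<close> is what the stationarity condition demands at the end of the chain.
\<close>

definition lin :: 'a where "lin = - (\<alpha> *\<^sub>R x0 + (l * k / ratio) *\<^sub>R e 0)"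

definition cost :: "'a \<Rightarrow> real" where "cost = quadratic (\<lambda>_. 0) 0 lin 0"

definition con :: "'a \<Rightarrow> real" where
  "con = quadratic (\<lambda>z. k *\<^sub>R chain z) x0 0 (- (offset \<bullet> (k *\<^sub>R chain offset) / 2))"

definition instance_problem :: "'a problem" where
  "instance_problem =
     \<lparr>ncon = 1, modulus = \<alpha>, radius = \<infinity>, Lip = (\<lambda>\<mu>. 4 * k * \<mu> 0),
      objective = cost, constr = (\<lambda>_. con)\<rparr>"

definition sol_multiplier :: "nat \<Rightarrow> real" where "sol_multiplier i = (if i = 0 then l else 0)"

lemma e_Suc: "orthonormal (\<lambda>i. e (Suc i))"
  by (rule orthonormal_comp_inj[OF e]) simp

lemma bounded_linear_chain: "bounded_linear chain"
  unfolding chain_def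
  by (intro bounded_linear_sub bounded_linear_transfer e e_Suc bounded_linear_scaleR_right)

lemma chain_symmetric: "x \<bullet> chain y = y \<bullet> chain x"
  unfolding chain_def
  using transfer_adjoint[OF e e_Suc, of x y] transfer_adjoint[OF e e_Suc, of y x]
  by (simp add: inner_diff_right inner_commute)

text \<open>Both shifts contribute \<open>\<langle>x, S x\<rangle>\<close>, which is at most \<open>\<parallel>x\<parallel>\<^sup>2\<close> as the shift is a contraction.\<close>

lemma chain_psd: "0 \<le> x \<bullet> chain x"
proof -
  have "x \<bullet> transfer e (\<lambda>i. e (Suc i)) x \<le> norm x * norm (transfer e (\<lambda>i. e (Suc i)) x)"
    by (rule norm_cauchy_schwarz)
  also have "\<dots> \<le> norm x * norm x"
    by (intro mult_left_mono norm_transfer_le e e_Suc) simp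
  finally show ?thesis
    unfolding chain_def using transfer_adjoint[OF e e_Suc, of x x]
    by (simp add: inner_diff_right dot_square_norm power2_eq_square)
qed

lemma norm_chain_le: "norm (chain x) \<le> 4 * norm x"
proof -
  have "norm (chain x) \<le> norm (2 *\<^sub>R x) + norm (transfer e (\<lambda>i. e (Suc i)) x)
      + norm (transfer (\<lambda>i. e (Suc i)) e x)"
    unfolding chain_def by (meson add_right_mono norm_triangle_ineq4 order_trans)
  then show ?thesis
    using norm_transfer_le[OF e e_Suc, of x] norm_transfer_le[OF e_Suc e, of x] by simp
qed

lemma chain_coordinate_Suc:
  "chain x \<bullet> e (Suc i) = 2 * (x \<bullet> e (Suc i)) - x \<bullet> e i - x \<bullet> e (Suc (Suc i))"
  unfolding chain_def
  using transfer_coordinate[OF e e_Suc, of i x] transfer_coordinate[OF e_Suc e, of "Suc i" x]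
  by (simp add: inner_diff_left inner_commute[of "transfer _ _ x"])

lemma root_cond_gt_1: "1 < root_cond"
  unfolding root_cond_def using pos by simp

lemma ratio_bounds: "0 < ratio" "ratio < 1"
  unfolding ratio_def using root_cond_gt_1 by simp_all

text \<open>
  The characteristic equation of the three-term recurrence
  \<open>(\<alpha> + 2 l k) z i = l k (z (i - 1) + z (i + 1))\<close>, of which \<open>ratio\<close> is the decaying root.
\<close>

lemma ratio_equation: "\<alpha> * ratio = l * k * (1 - ratio)\<^sup>2"
proof -
  have "root_cond\<^sup>2 = 1 + 4 * l * k / \<alpha>"
    unfolding root_cond_def using pos by simp
  then have sq: "\<alpha> * (root_cond\<^sup>2 - 1) = 4 * (l * k)" using pos by simp
  have "1 - ratio = 2 / (root_cond + 1)"
    unfolding ratio_def using root_cond_gt_1 by (simp add: field_simps)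
  then have "l * k * (1 - ratio)\<^sup>2 = 4 * (l * k) / (root_cond + 1)\<^sup>2"
    by (simp add: power_divide)
  also have "\<dots> = \<alpha> * (root_cond\<^sup>2 - 1) / (root_cond + 1)\<^sup>2" by (simp add: sq)
  also have "root_cond\<^sup>2 - 1 = (root_cond - 1) * (root_cond + 1)"
    by (simp add: power2_eq_square algebra_simps)
  also have "\<alpha> * ((root_cond - 1) * (root_cond + 1)) / (root_cond + 1)\<^sup>2 = \<alpha> * ratio"
    unfolding ratio_def using root_cond_gt_1 by (simp add: power2_eq_square)
  finally show ?thesis by simp
qed

lemma summable_ratio: "summable (\<lambda>i. (ratio ^ i)\<^sup>2)"
proof -
  have "summable (\<lambda>i. (ratio\<^sup>2) ^ i)"
    using ratio_bounds by (intro summable_geometric) (simp add: abs_square_less_1)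
  then show ?thesis by (simp add: power_mult[symmetric] mult.commute)
qed

lemma offset_coordinate: "offset \<bullet> e j = ratio ^ j"
  using orthonormal_series_coordinate[OF e summable_ratio, of j]
  unfolding offset_def by (simp add: inner_commute)

text \<open>
  On a geometric sequence the left shift acts as multiplication by \<open>ratio\<close>, and the right shift as
  division by \<open>ratio\<close> after the term at \<open>e 0\<close> has been removed.  The characteristic equation cancels
  everything except that boundary term.
\<close>

lemma chain_offset:
  "\<alpha> *\<^sub>R offset + (l * k) *\<^sub>R chain offset = (l * k / ratio) *\<^sub>R e 0"
proof -
  let ?up = "transfer e (\<lambda>i. e (Suc i)) offset" and ?down = "transfer (\<lambda>i. e (Suc i)) e offset"
  have ups: "(\<lambda>i. ratio ^ i *\<^sub>R e (Suc i)) sums ?up"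
    unfolding transfer_def offset_coordinate
    by (rule summable_sums[OF summable_orthonormal_series[OF e_Suc summable_ratio]])
  have "(\<lambda>i. ratio ^ Suc i *\<^sub>R e (Suc i)) sums (ratio *\<^sub>R ?up)"
    using bounded_linear.sums[OF bounded_linear_scaleR_right ups, of ratio] by simp
  moreover have "(\<lambda>i. ratio ^ i *\<^sub>R e i) sums offset"
    unfolding offset_def by (rule summable_sums[OF summable_orthonormal_series[OF e summable_ratio]])
  then have "(\<lambda>i. ratio ^ Suc i *\<^sub>R e (Suc i)) sums (offset - e 0)"
    using sums_Suc_iff[of "\<lambda>i. ratio ^ i *\<^sub>R e i" "offset - e 0"] by simp
  ultimately have "ratio *\<^sub>R ?up = offset - e 0" by (rule sums_unique2)
  moreover have "?up = (1 / ratio) *\<^sub>R (ratio *\<^sub>R ?up)"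
    using ratio_bounds by simp
  ultimately have up: "?up = (1 / ratio) *\<^sub>R (offset - e 0)" by simp
  have "(\<lambda>i. ratio ^ Suc i *\<^sub>R e i) sums (ratio *\<^sub>R offset)"
    using bounded_linear.sums[OF bounded_linear_scaleR_right
        \<open>(\<lambda>i. ratio ^ i *\<^sub>R e i) sums offset\<close>, of ratio] by simp
  then have down: "?down = ratio *\<^sub>R offset"
    unfolding transfer_def offset_coordinate by (simp add: sums_iff)
  have "\<alpha> *\<^sub>R offset + (l * k) *\<^sub>R chain offset
      = (\<alpha> + l * k * (2 - 1 / ratio - ratio)) *\<^sub>R offset + (l * k / ratio) *\<^sub>R e 0"
    unfolding chain_def up down by (simp add: algebra_simps)
  also have "\<alpha> + l * k * (2 - 1 / ratio - ratio) = (\<alpha> * ratio - l * k * (1 - ratio)\<^sup>2) / ratio"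
    using ratio_bounds by (simp add: field_simps power2_eq_square)
  finally show ?thesis by (simp add: ratio_equation)
qed

lemma bounded_scaled_chain: "bounded_linear (\<lambda>z. r *\<^sub>R chain z)"
  by (intro bounded_linear_compose[OF bounded_linear_scaleR_right bounded_linear_chain])

lemma scaled_chain_symmetric: "x \<bullet> (r *\<^sub>R chain y) = y \<bullet> (r *\<^sub>R chain x)"
  by (simp add: chain_symmetric)

lemma GDERIV_cost: "GDERIV cost x :> lin"
  unfolding cost_def using GDERIV_quadratic[of "\<lambda>_. 0" 0 lin 0 x] by (simp add: bounded_linear_zero)

lemma GDERIV_con: "GDERIV con x :> k *\<^sub>R chain (x - x0)"
  unfolding con_def
  using GDERIV_quadratic[OF bounded_scaled_chain scaled_chain_symmetric, of k x0 0] by simp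

lemmas gradient_cost = gradient_eqI[OF GDERIV_cost]
lemmas gradient_con = gradient_eqI[OF GDERIV_con]

lemma instance_simps [simp]:
  "ncon instance_problem = 1" "modulus instance_problem = \<alpha>" "radius instance_problem = \<infinity>"
  "Lip instance_problem = (\<lambda>\<mu>. 4 * k * \<mu> 0)"
  "objective instance_problem = cost" "constr instance_problem i = con"
  unfolding instance_problem_def by simp_all

lemma con_sol: "con sol = 0"
  unfolding con_def quadratic_def sol_def by simp

lemma sol_feasible: "sol \<in> feasible instance_problem"
  unfolding feasible_def domain_ball_def by (simp add: con_sol)

lemma stationary: "lin + \<alpha> *\<^sub>R sol + (l * k) *\<^sub>R chain (sol - x0) = 0"
  unfolding lin_def sol_def using chain_offset by (simp add: algebra_simps)

lemma KKT_sol: "KKT_multiplier instance_problem sol sol_multiplier"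
  unfolding KKT_multiplier_def
  using stationary sol_feasible pos
  by (simp add: nonneg_multipliers_def sol_multiplier_def con_sol gradient_cost gradient_con)

text \<open>
  Weak duality: by stationarity, the Lagrangian exceeds its value at \<open>sol\<close> by a nonnegative quadratic
  form in \<open>x - sol\<close>; at feasible points it is below the objective, and at \<open>sol\<close> the two agree.
\<close>

lemma optimal_sol: "optimal_solution instance_problem sol"
  unfolding optimal_solution_def
proof (intro conjI ballI)
  show "sol \<in> feasible instance_problem" by (rule sol_feasible)
  fix x assume "x \<in> feasible instance_problem"
  then have x: "con x \<le> 0" unfolding feasible_def by simp
  define d where "d = x - sol"
  have cost: "cost x = cost sol + lin \<bullet> d"
    unfolding cost_def quadratic_def d_def by (simp add: inner_diff_right)
  have con: "con x = con sol + (k *\<^sub>R chain (sol - x0)) \<bullet> d + d \<bullet> (k *\<^sub>R chain d) / 2"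
    unfolding con_def d_def
    by (subst quadratic_expansion[OF bounded_scaled_chain scaled_chain_symmetric, where x = sol]) simp
  have "x = sol + d" unfolding d_def by simp
  then have reg: "(norm x)\<^sup>2 = (norm sol)\<^sup>2 + 2 * (sol \<bullet> d) + (norm d)\<^sup>2"
    by (simp add: power2_norm_eq_inner inner_add_left inner_add_right inner_commute)
  have "(lin + \<alpha> *\<^sub>R sol + (l * k) *\<^sub>R chain (sol - x0)) \<bullet> d = 0" by (simp add: stationary)
  then have "cost x + \<alpha> / 2 * (norm x)\<^sup>2 + l * con x
      = cost sol + \<alpha> / 2 * (norm sol)\<^sup>2 + \<alpha> / 2 * (norm d)\<^sup>2 + l * k * (d \<bullet> chain d) / 2"
    unfolding cost con reg con_sol by (simp add: inner_add_left algebra_simps)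
  moreover have "0 \<le> \<alpha> / 2 * (norm d)\<^sup>2" "0 \<le> l * k * (d \<bullet> chain d) / 2"
    using pos chain_psd[of d] by simp_all
  moreover have "l * con x \<le> 0" using x pos by (simp add: mult_le_0_iff)
  ultimately show "total_objective instance_problem sol \<le> total_objective instance_problem x"
    unfolding total_objective_def regularizer_def by simp
qed

lemma admissible_instance: "admissible instance_problem"
proof -
  have "convex_smooth cost"
    unfolding cost_def by (rule convex_smooth_quadratic) (simp_all add: bounded_linear_zero)
  moreover have "convex_smooth con"
    unfolding con_def using pos chain_psd
    by (intro convex_smooth_quadratic[OF bounded_scaled_chain scaled_chain_symmetric]) simp
  moreover have "(4 * k * r)-lipschitz_on UNIV (gradient (\<lambda>x. cost x + r * con x))"
    if "0 \<le> r" for r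
  proof -
    have "gradient (\<lambda>x. cost x + r * con x) x = (r * k) *\<^sub>R chain (x - x0) + lin" for x
    proof (rule gradient_eqI)
      show "GDERIV (\<lambda>x. cost x + r * con x) x :> (r * k) *\<^sub>R chain (x - x0) + lin"
        using GDERIV_cost[of x] GDERIV_con[of x] unfolding gderiv_def
        by (auto intro!: derivative_eq_intros simp: inner_add_right fun_eq_iff)
    qed
    then have eq: "gradient (\<lambda>x. cost x + r * con x) = (\<lambda>x. (r * k) *\<^sub>R chain (x - x0) + lin)"
      by blast
    have "norm ((r * k) *\<^sub>R chain x) \<le> 4 * k * r * norm x" for x
      using mult_left_mono[OF norm_chain_le[of x], of "r * k"] that pos by (simp add: mult_ac)
    then show ?thesis
      unfolding eq using that pos
      by (intro lipschitz_affine_field[OF bounded_scaled_chain scaled_chain_symmetric]) auto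
  qed
  ultimately show ?thesis
    unfolding admissible_def using pos optimal_sol KKT_sol
    by (auto simp: nonneg_multipliers_def)
qed

lemma aggregate_Lip_instance:
  "aggregate_Lip instance_problem (multiplier_set instance_problem sol_multiplier 1) \<le> ereal (4 * k * (l + 1))"
proof -
  have "4 * k * \<nu> 0 \<le> 4 * k * (l + 1)" if "\<nu> \<in> multiplier_set instance_problem sol_multiplier 1" for \<nu>
  proof -
    have "\<nu> 0 \<le> l + 1"
      using that pos
      by (auto simp: multiplier_set_def multiplier_norm_def nonneg_multipliers_def sol_multiplier_def L2_set_def)
    then show ?thesis using pos by simp
  qed
  then show ?thesis unfolding aggregate_Lip_def by (auto intro!: SUP_least)
qed

text \<open>
  The points whose component in the closed span of \<open>e\<close> uses only the first \<open>n\<close> directions; the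
  orthogonal complement of \<open>e\<close>, which contains \<open>x0\<close>, is left free.
\<close>

definition revealed :: "nat \<Rightarrow> 'a set" where "revealed n = {x. \<forall>i\<ge>n. x \<bullet> e i = 0}"

lemma subspace_revealed: "subspace (revealed n)"
  unfolding revealed_def by (auto simp: subspace_def inner_add_left)

lemma chain_revealed:
  assumes "x \<in> revealed n"
  shows "chain x \<in> revealed (Suc n)"
  unfolding revealed_def
proof (intro CollectI allI impI)
  fix i assume "Suc n \<le> i"
  then obtain j where "i = Suc j" "n \<le> j" by (auto dest: Suc_le_D)
  then show "chain x \<bullet> e i = 0"
    using assms unfolding revealed_def by (simp add: chain_coordinate_Suc)
qed

lemma reachable_revealed:
  assumes "S \<subseteq> revealed n"
  shows "reachable instance_problem S \<subseteq> revealed (Suc n)"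
proof
  fix w assume "w \<in> reachable instance_problem S"
  then obtain x y \<eta> and \<tau> :: "nat \<Rightarrow> real" where "x \<in> S" "y \<in> S"
      and w: "w = x + \<eta> *\<^sub>R lin + (\<tau> 0 * k) *\<^sub>R chain (y - x0)"
    unfolding reachable_def by (auto simp: gradient_cost gradient_con)
  with assms have xy: "x \<in> revealed n" "y \<in> revealed n" by auto
  have x0: "x0 \<in> revealed m" for m unfolding revealed_def by (simp add: x0_e)
  have "x \<in> revealed (Suc n)" using xy(1) unfolding revealed_def by simp
  moreover have "lin \<in> revealed (Suc n)"
    unfolding revealed_def lin_def by (auto simp: inner_add_left inner_diff_left x0_e orthonormalD[OF e])
  moreover have "chain (y - x0) \<in> revealed (Suc n)"
    by (intro chain_revealed subspace_diff[OF subspace_revealed] xy x0)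
  ultimately show "w \<in> revealed (Suc n)"
    unfolding w by (intro subspace_add subspace_scale subspace_revealed)
qed

text \<open>
  The index of the newest direction is tied to the number of queries: \<open>x0\<close> reveals nothing, the
  gradient of the objective contributes \<open>e 0\<close>, and the constraint passes from \<open>e i\<close> to \<open>e (i + 1)\<close>.
\<close>

lemma memory_revealed:
  assumes "first_order_method A"
  shows "memory_at A instance_problem x0 n \<subseteq> revealed n"
proof (induction n)
  case 0
  then show ?case
    using assms admissible_instance unfolding first_order_method_def revealed_def
    by (auto simp: x0_e)
next
  case (Suc n)
  have "span (memory_at A instance_problem x0 n) \<subseteq> revealed n"
    by (rule span_minimal[OF Suc subspace_revealed])
  then show ?case
    using assms admissible_instance reachable_revealed unfolding first_order_method_def by blast
qed

text \<open>
  Moving \<open>offset\<close> along the sequence by \<open>n\<close> places gives a vector \<open>w\<close> of the same norm that sees only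
  the coordinates missing from \<open>x\<close>.  There \<open>sol - x\<close> has coordinates \<open>ratio ^ (n + i)\<close>, that is
  \<open>ratio ^ n\<close> times those of \<open>w\<close>, so testing the error against \<open>w\<close> gives the bound.
\<close>

lemma revealed_error:
  assumes "x \<in> revealed n"
  shows "ratio ^ n * norm offset \<le> norm (x - sol)"
proof -
  have en: "orthonormal (\<lambda>i. e (n + i))"
    by (rule orthonormal_comp_inj[OF e]) simp
  define w where "w = (\<Sum>i. ratio ^ i *\<^sub>R e (n + i))"
  have offs: "(\<lambda>i. (ratio ^ i)\<^sup>2) sums (norm offset)\<^sup>2"
    unfolding offset_def by (rule Parseval_orthonormal_series[OF e summable_ratio])
  moreover have "(\<lambda>i. (ratio ^ i)\<^sup>2) sums (norm w)\<^sup>2"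
    unfolding w_def by (rule Parseval_orthonormal_series[OF en summable_ratio])
  ultimately have "(norm w)\<^sup>2 = (norm offset)\<^sup>2" by (rule sums_unique2[symmetric])
  then have w: "norm w = norm offset" by (simp add: power2_eq_iff_nonneg)
  have "(sol - x) \<bullet> e (n + i) = ratio ^ n * ratio ^ i" for i
    using assms unfolding sol_def revealed_def
    by (simp add: inner_diff_left inner_add_left x0_e offset_coordinate power_add)
  then have "(\<lambda>i. ratio ^ n * (ratio ^ i)\<^sup>2) sums ((sol - x) \<bullet> w)"
    using inner_orthonormal_series[OF en summable_ratio, of "sol - x"] unfolding w_def
    by (simp add: power2_eq_square mult_ac)
  then have "ratio ^ n * (norm offset)\<^sup>2 = (sol - x) \<bullet> w"
    using sums_mult[OF offs, of "ratio ^ n"] sums_unique2 by blast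
  also have "\<dots> \<le> norm (sol - x) * norm offset"
    using norm_cauchy_schwarz[of "sol - x" w] w by simp
  finally have "ratio ^ n * norm offset * norm offset \<le> norm (x - sol) * norm offset"
    by (simp add: power2_eq_square mult_ac norm_minus_commute)
  moreover have "0 < norm offset"
    using offset_coordinate[of 0] by auto
  ultimately show ?thesis by simp
qed

text \<open>
  From \<open>ln y \<le> y - 1\<close> one gets \<open>2 / (root_cond - 1)\<close>.  The assumption \<open>2 \<le> r\<close> keeps the
  condition number away from \<open>1\<close>, so that \<open>root_cond - 1\<close> is at least a fixed multiple of \<open>sqrt r\<close>.
\<close>

lemma ln_inverse_ratio_le:
  assumes r: "2 \<le> r" "r / 2 \<le> 4 * l * k / \<alpha>"
  shows "- ln ratio \<le> 8 / sqrt r"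
proof -
  \<comment> \<open>Expanding \<open>(1 + sqrt r / 4)\<^sup>2 \<le> 1 + r / 2\<close> shows that it amounts to \<open>8 / 7 \<le> sqrt r\<close>.\<close>
  have "sqrt 2 \<le> sqrt r" using r by simp
  moreover have "(8 / 7)\<^sup>2 \<le> (2 :: real)" by (simp add: power2_eq_square)
  then have "8 / 7 \<le> sqrt (2 :: real)" by (rule real_le_rsqrt)
  ultimately have "8 / 7 \<le> sqrt r" by (rule order_trans[rotated])
  then have "8 / 7 * sqrt r \<le> sqrt r * sqrt r" using r by (intro mult_right_mono) auto
  then have "8 * sqrt r \<le> 7 * r" using r by simp
  then have "(1 + sqrt r / 4)\<^sup>2 \<le> 1 + 4 * l * k / \<alpha>"
    using r by (simp add: power2_sum power_divide)
  then have s: "1 + sqrt r / 4 \<le> root_cond"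
    unfolding root_cond_def by (rule real_le_rsqrt)
  have "- ln ratio = ln (1 / ratio)" using ratio_bounds by (simp add: ln_div)
  also have "\<dots> \<le> 1 / ratio - 1" using ratio_bounds by (intro ln_le_minus_one) simp
  also have "\<dots> = 2 / (root_cond - 1)"
    unfolding ratio_def using root_cond_gt_1 by (simp add: field_simps)
  also have "\<dots> \<le> 2 / (sqrt r / 4)"
    using s r root_cond_gt_1 by (intro divide_left_mono mult_pos_pos) auto
  finally show ?thesis by simp
qed

lemma query_lower_bound:
  assumes A: "first_order_method A"
    and r: "2 \<le> r" "r / 2 \<le> 4 * l * k / \<alpha>"
    and \<epsilon>: "0 < \<epsilon>" "(norm (iterate_at A instance_problem x0 n - sol))\<^sup>2 \<le> \<epsilon>"
  shows "1 / 16 * sqrt r * ln ((norm (x0 - sol))\<^sup>2 / \<epsilon>) \<le> real n"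
proof -
  define D where "D = (norm offset)\<^sup>2"
  have "0 < D" unfolding D_def using offset_coordinate[of 0] by auto
  have "iterate_at A instance_problem x0 n \<in> revealed n"
    using A admissible_instance memory_revealed[OF A, of n] unfolding first_order_method_def by blast
  then have "(ratio ^ n * norm offset)\<^sup>2 \<le> (norm (iterate_at A instance_problem x0 n - sol))\<^sup>2"
    using ratio_bounds by (intro power_mono revealed_error) auto
  then have "(ratio ^ n)\<^sup>2 * D \<le> \<epsilon>"
    using \<epsilon>(2) unfolding D_def by (simp add: power_mult_distrib)
  then have "ln ((ratio ^ n)\<^sup>2 * D) \<le> ln \<epsilon>"
    using ratio_bounds \<open>0 < D\<close> \<epsilon>(1) by (subst ln_le_cancel_iff) auto
  then have "ln (D / \<epsilon>) \<le> 2 * (n * (- ln ratio))"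
    using ratio_bounds \<open>0 < D\<close> \<epsilon>(1) by (simp add: ln_mult ln_div ln_realpow)
  also have "\<dots> \<le> 2 * (n * (8 / sqrt r))"
    using ln_inverse_ratio_le[OF r] by (intro mult_left_mono) auto
  finally have "1 / 16 * sqrt r * ln (D / \<epsilon>) \<le> 1 / 16 * sqrt r * (2 * (n * (8 / sqrt r)))"
    using r by (intro mult_left_mono) auto
  also have "\<dots> = n" using r by simp
  finally show ?thesis unfolding D_def sol_def by simp
qed

lemma sol_ne_start: "sol \<noteq> x0"
  unfolding sol_def using offset_coordinate[of 0] by auto

lemma affine_cost: "affine_function cost"
  unfolding affine_function_def cost_def quadratic_def
  by (intro exI[of _ "\<lambda>x. lin \<bullet> x"] exI[of _ 0])
     (auto intro: bounded_linear.linear bounded_linear_inner_right)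

lemma multiplier_norm_sol_multiplier: "multiplier_norm instance_problem sol_multiplier = l"
  unfolding multiplier_norm_def using pos by (simp add: sol_multiplier_def L2_set_def)

end

theorem theorem3:
  assumes infinite_dim: "\<nexists>B :: 'a::{real_inner, complete_space} set. finite B \<and> span B = UNIV"
  shows "\<exists>C::real. C > 0 \<and>
    (\<forall>(l::real) (\<alpha>::real) (Lbar::real). l \<ge> 1 \<and> \<alpha> > 0 \<and> Lbar \<ge> 2 * \<alpha> \<longrightarrow>
      (\<forall>(A :: 'a fo_rules) (x0 :: 'a). first_order_method A \<longrightarrow>
        (\<exists>(P :: 'a problem) xs \<mu>.
           admissible P \<and> modulus P = \<alpha> \<and>
           optimal_solution P xs \<and> KKT_multiplier P xs \<mu> \<and>
           multiplier_norm P \<mu> = l \<and>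
           affine_function (objective P) \<and>
           aggregate_Lip P (multiplier_set P \<mu> 1) \<le> ereal Lbar \<and>
           xs \<noteq> x0 \<and>
           (\<forall>(\<epsilon>::real) (N::nat). 0 < \<epsilon> \<and> \<epsilon> \<le> (norm (x0 - xs))\<^sup>2 \<and>
              (norm (iterate_at A P x0 N - xs))\<^sup>2 \<le> \<epsilon> \<longrightarrow>
              real N \<ge> C * sqrt (Lbar / \<alpha>) * ln ((norm (x0 - xs))\<^sup>2 / \<epsilon>)))))"
proof (intro exI[of _ "1 / 16 :: real"] conjI allI impI)
  show "0 < (1 / 16 :: real)" by simp
next
  fix l \<alpha> Lbar :: real and A :: "'a fo_rules" and x0 :: 'a
  assume lab: "l \<ge> 1 \<and> \<alpha> > 0 \<and> Lbar \<ge> 2 * \<alpha>" and A: "first_order_method A"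
  obtain e :: "nat \<Rightarrow> 'a" where e: "orthonormal e" "\<And>i. x0 \<bullet> e i = 0"
    using orthonormal_sequence_orthogonal_to[OF infinite_dim] by blast
  \<comment> \<open>The multipliers in \<open>\<Lambda>_1\<close> reach \<open>l + 1\<close>, and the gradient of the constraint has Lipschitz
    constant \<open>4 k\<close>.\<close>
  define k where "k = Lbar / (4 * (l + 1))"
  have "0 < Lbar" using lab by linarith
  then have "0 < k" unfolding k_def using lab by simp
  then interpret chain_instance e x0 \<alpha> l k
    using e lab by unfold_locales auto
  have "l + 1 \<noteq> 0" using lab by linarith
  then have Lbar: "4 * k * (l + 1) = Lbar" unfolding k_def by (simp add: field_simps)
  have "4 * k * 1 \<le> 4 * k * l" using \<open>0 < k\<close> lab by (intro mult_left_mono) auto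
  then have "Lbar / 2 \<le> 4 * l * k" using Lbar by (simp add: algebra_simps)
  then have r: "2 \<le> Lbar / \<alpha>" "Lbar / \<alpha> / 2 \<le> 4 * l * k / \<alpha>"
    using lab by (simp_all add: field_simps)
  show "\<exists>(P :: 'a problem) xs \<mu>.
           admissible P \<and> modulus P = \<alpha> \<and>
           optimal_solution P xs \<and> KKT_multiplier P xs \<mu> \<and>
           multiplier_norm P \<mu> = l \<and>
           affine_function (objective P) \<and>
           aggregate_Lip P (multiplier_set P \<mu> 1) \<le> ereal Lbar \<and>
           xs \<noteq> x0 \<and>
           (\<forall>(\<epsilon>::real) (N::nat). 0 < \<epsilon> \<and> \<epsilon> \<le> (norm (x0 - xs))\<^sup>2 \<and>
              (norm (iterate_at A P x0 N - xs))\<^sup>2 \<le> \<epsilon> \<longrightarrow>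
              real N \<ge> 1 / 16 * sqrt (Lbar / \<alpha>) * ln ((norm (x0 - xs))\<^sup>2 / \<epsilon>))"
    using admissible_instance optimal_sol KKT_sol multiplier_norm_sol_multiplier affine_cost
      aggregate_Lip_instance sol_ne_start query_lower_bound[OF A r]
    unfolding Lbar
    by (intro exI[of _ instance_problem] exI[of _ sol] exI[of _ sol_multiplier]) simp
qed

end
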